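(* Let $\bm{\gamma}=(\gamma_0,\gamma_1,\ldots)\in\{0,1\}^{\infty}$, let $A\subseteq\mathbb{Z}_{\geq0}$ be finite, and let $m=\mathrm{mex}\,A$. Then $\{{\ast}^{\bm{\gamma}}i:i\in A\}^{\gamma_m}={\ast}^{\bm{\gamma}}m$ if and only if either $\gamma_i=0$ for some $i\le m$, or $\gamma_i=1$ for every $i\in A$.
   Context: Let $\mathcal{B}=\{0,1\}$. Define $\mathbb{I}_0=\{\emptyset\}\times\mathcal{B}$ and $\mathbb{I}_n=2^{\mathbb{I}_{n-1}}\times\mathcal{B}$ for $n\ge1$; a game with activeness is an element of $\mathbb{I}=\bigcup_{n\ge0}\mathbb{I}_n$. A pair $(G,g)$ is written $G^g$; elements of $G$ are its options, $g=1$ meaning active. The outcome $o$ is defined recursively: $o(G^g)=\mathscr{N}$ if $g=1$ and some option has outcome $\mathscr{P}$, and $o(G^g)=\mathscr{P}$ otherwise. The sum is $G^g+H^h=(\{G'^{g'}+H^h:G'^{g'}\in G^g\}\cup\{G^g+H'^{h'}:H'^{h'}\in H^h\})^{\max\{g,h\}}$. $G^g=H^h$ means $o(G^g+X^x)=o(H^h+X^x)$ for all games $X^x$. For $\bm{\gamma}=(\gamma_0,\gamma_1,\ldots)\in\mathcal{B}^\infty$, the nimbers are defined recursively by ${\ast}^{\bm{\gamma}}i=\{{\ast}^{\bm{\gamma}}j:0\le j<i\}^{\gamma_i}$. $\mathrm{mex}\,A=\min(\mathbb{Z}_{\ge0}\setminus A)$. *)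

theory Defs
  imports Main "HOL-Library.FSet"
begin

text \<open>
  Activeness values are booleans, \<open>True\<close> standing for 1 (active) and \<open>False\<close> for 0, so that
  the maximum of two of them is their disjunction. As \<open>\<I>\<^sub>0\<close> is finite, so is every \<open>\<I>\<^sub>n\<close>, and
  every game has a finite set of options; the union of all \<open>\<I>\<^sub>n\<close> is thus the following datatype
  (see \<open>game_in_level\<close> below).
\<close>

datatype game = Game (options: "game fset") (active: bool)

fun level :: "nat \<Rightarrow> game set" where
  "level 0 = {Game {||} b | b. True}"
| "level (Suc n) = {Game F b | F b. fset F \<subseteq> level n}"

lemma level_Suc_mono: "level n \<subseteq> level (Suc n)"
  by (induction n) auto

lemma level_mono: "m \<le> n \<Longrightarrow> level m \<subseteq> level n"
  by (rule lift_Suc_mono_le[of level, OF level_Suc_mono])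

lemma finite_level: "finite (level n)"
proof (induction n)
  case 0
  have "level 0 = range (Game {||})" by auto
  then show ?case by simp
next
  case (Suc n)
  have "level (Suc n) \<subseteq> (\<lambda>(S, b). Game (Abs_fset S) b) ` (Pow (level n) \<times> UNIV)"
  proof
    fix G assume "G \<in> level (Suc n)"
    then obtain F b where "G = Game F b" "fset F \<subseteq> level n" by auto
    then show "G \<in> (\<lambda>(S, b). Game (Abs_fset S) b) ` (Pow (level n) \<times> UNIV)"
      by (intro image_eqI[of _ _ "(fset F, b)"]) (auto simp: fset_inverse)
  qed
  then show ?case using Suc finite_subset by fastforce
qed

lemma game_in_level: "\<exists>n. G \<in> level n"
proof (induction G)
  case (Game F b)
  then obtain k where k: "\<And>H. H \<in> fset F \<Longrightarrow> H \<in> level (k H)" by metis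
  define N where "N = Max (insert 0 (k ` fset F))"
  have "k H \<le> N" if "H \<in> fset F" for H
    unfolding N_def using that by (intro Max_ge) auto
  then have "fset F \<subseteq> level N" using k level_mono by blast
  then have "Game F b \<in> level (Suc N)" by auto
  then show ?case ..
qed

lemma size_option: "G' |\<in>| options G \<Longrightarrow> size G' < size G"
proof (cases G)
  case (Game F b)
  assume "G' |\<in>| options G"
  then have "G' \<in> fset F" using Game by simp
  then have "Suc (size G') \<le> (\<Sum>x\<in>fset F. Suc (size x))"
    by (intro member_le_sum) auto
  then show ?thesis using Game by simp
qed

datatype outcome = \<N> | \<P>

function outcome_of :: "game \<Rightarrow> outcome" where
  "outcome_of G = (if active G \<and> (\<exists>G' \<in> fset (options G). outcome_of G' = \<P>) then \<N> else \<P>)"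
  by auto
termination
  by (relation "measure size") (auto intro: size_option)

declare outcome_of.simps [simp del]

function game_sum :: "game \<Rightarrow> game \<Rightarrow> game" (infixl "\<oplus>" 65) where
  "G \<oplus> H = Game (((\<lambda>G'. G' \<oplus> H) |`| options G) |\<union>| ((\<lambda>H'. G \<oplus> H') |`| options H))
                 (active G \<or> active H)"
  by auto
termination
  by (relation "measure (\<lambda>(G, H). size G + size H)") (auto intro: size_option)

declare game_sum.simps [simp del]

definition game_eq :: "game \<Rightarrow> game \<Rightarrow> bool" (infix "\<doteq>" 50) where
  "G \<doteq> H \<longleftrightarrow> (\<forall>X. outcome_of (G \<oplus> X) = outcome_of (H \<oplus> X))"

text \<open>\<open>Abs_fset\<close> is inverse to \<open>fset\<close> on finite sets, but unspecified on infinite ones.\<close>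

fun nimber :: "(nat \<Rightarrow> bool) \<Rightarrow> nat \<Rightarrow> game" where
  "nimber \<gamma> i = Game (Abs_fset ((\<lambda>j. nimber \<gamma> j) ` {0..<i})) (\<gamma> i)"

declare nimber.simps [simp del]

definition mex :: "nat set \<Rightarrow> nat" where
  "mex A = (LEAST n. n \<notin> A)"

end

theory Submission
  imports Defs
begin

text \<open>
  Let \<open>G\<close> arise from \<open>K\<close> by adding options that have \<open>K\<close> as an option. A move in \<open>G + X\<close> to such an
  option \<open>L\<close> can be reverted to \<open>K + X\<close>, unless \<open>L + X\<close> is inactive. In that case the move wins at
  once, but if \<open>K\<close> has an inactive option \<open>K'\<close>, then so does the move from \<open>K + X\<close> to \<open>K' + X\<close>.
  Conversely, if \<open>K\<close> and all its options are active, then the inactive game with the options of \<open>K\<close>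
  distinguishes \<open>K\<close> from every active game with an inactive option. For \<open>K = \<ast>m\<close>, every surplus option
  is some \<open>\<ast>k\<close> with \<open>k > m\<close>.
\<close>

lemma option_induct [case_names option]:
  assumes "\<And>G. (\<And>G'. G' |\<in>| options G \<Longrightarrow> P G') \<Longrightarrow> P G"
  shows "P G"
  using assms size_option by (induction G rule: measure_induct_rule[of size]) blast

lemma active_sum: "active (G \<oplus> H) \<longleftrightarrow> active G \<or> active H"
  by (subst game_sum.simps) simp

lemma fset_options_sum:
  "fset (options (G \<oplus> H)) =
    (\<lambda>G'. G' \<oplus> H) ` fset (options G) \<union> (\<lambda>H'. G \<oplus> H') ` fset (options H)"
  by (subst game_sum.simps) simp

lemma outcome_neq_N_iff: "x \<noteq> \<N> \<longleftrightarrow> x = \<P>"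
  by (cases x) auto

lemma outcome_of_eq_N_iff:
  "outcome_of G = \<N> \<longleftrightarrow> active G \<and> (\<exists>G' |\<in>| options G. outcome_of G' = \<P>)"
  by (subst outcome_of.simps) simp

lemma outcome_sum_eq_N_iff:
  "outcome_of (G \<oplus> H) = \<N> \<longleftrightarrow> (active G \<or> active H) \<and>
    ((\<exists>G' |\<in>| options G. outcome_of (G' \<oplus> H) = \<P>) \<or>
     (\<exists>H' |\<in>| options H. outcome_of (G \<oplus> H') = \<P>))"
  unfolding outcome_of_eq_N_iff[of "G \<oplus> H"] active_sum fset_options_sum by blast

lemma outcome_sum_N_leftI:
  assumes "active G \<or> active H" "G' |\<in>| options G" "outcome_of (G' \<oplus> H) = \<P>"
  shows "outcome_of (G \<oplus> H) = \<N>"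
  using assms outcome_sum_eq_N_iff by blast

lemma outcome_sum_N_rightI:
  assumes "active G \<or> active H" "H' |\<in>| options H" "outcome_of (G \<oplus> H') = \<P>"
  shows "outcome_of (G \<oplus> H) = \<N>"
  using assms outcome_sum_eq_N_iff by blast

lemma outcome_sum_PI:
  assumes "\<And>G'. G' |\<in>| options G \<Longrightarrow> outcome_of (G' \<oplus> H) = \<N>"
    and "\<And>H'. H' |\<in>| options H \<Longrightarrow> outcome_of (G \<oplus> H') = \<N>"
  shows "outcome_of (G \<oplus> H) = \<P>"
  using assms outcome_sum_eq_N_iff[of G H] outcome_neq_N_iff by fastforce

lemma outcome_sum_inactive:
  assumes "\<not> active G" "\<not> active H"
  shows "outcome_of (G \<oplus> H) = \<P>"
  using assms outcome_sum_eq_N_iff outcome_neq_N_iff by blast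

lemma outcome_sum_same: "outcome_of (G \<oplus> G) = \<P>"
proof (induction G rule: option_induct)
  case (option G)
  show ?case
  proof (cases "active G")
    case True
    then show ?thesis
      using option outcome_sum_N_leftI outcome_sum_N_rightI by (intro outcome_sum_PI) blast+
  next
    case False
    then show ?thesis using outcome_sum_inactive by blast
  qed
qed

lemma game_eq_imp_active:
  assumes "G \<doteq> K" "active K"
  shows "active G"
proof (rule ccontr)
  assume "\<not> active G"
  define X where "X = Game {|K|} False"
  have "outcome_of (G \<oplus> X) = \<P>"
    using \<open>\<not> active G\<close> by (simp add: outcome_sum_inactive X_def)
  moreover have "outcome_of (K \<oplus> X) = \<N>"
    using \<open>active K\<close> outcome_sum_same by (intro outcome_sum_N_rightI) (auto simp: X_def)
  ultimately show False using \<open>G \<doteq> K\<close> by (simp add: game_eq_def)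
qed

definition locally_active :: "game \<Rightarrow> bool" where
  "locally_active G \<longleftrightarrow> active G \<and> (\<forall>G' |\<in>| options G. active G')"

definition deactivate :: "game \<Rightarrow> game" where
  "deactivate G = Game (options G) False"

lemma active_deactivate [simp]: "\<not> active (deactivate G)"
  by (simp add: deactivate_def)

lemma options_deactivate [simp]: "options (deactivate G) = options G"
  by (simp add: deactivate_def)

lemma outcome_sum_deactivate:
  assumes "locally_active K"
  shows "outcome_of (K \<oplus> deactivate K) = \<P>"
proof (rule outcome_sum_PI)
  fix K' assume K': "K' |\<in>| options K"
  with assms have "active K'" by (simp add: locally_active_def)
  then show "outcome_of (K' \<oplus> deactivate K) = \<N>"
    using K' outcome_sum_same by (intro outcome_sum_N_rightI) auto
next
  fix K' assume "K' |\<in>| options (deactivate K)"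
  moreover have "active K" using assms by (simp add: locally_active_def)
  ultimately show "outcome_of (K \<oplus> K') = \<N>"
    using outcome_sum_same by (intro outcome_sum_N_leftI) auto
qed

lemma game_eq_imp_locally_active:
  assumes "G \<doteq> K" "locally_active K"
  shows "locally_active G"
proof -
  have "active G" using assms game_eq_imp_active by (simp add: locally_active_def)
  moreover have "active L" if "L |\<in>| options G" for L
  proof (rule ccontr)
    assume "\<not> active L"
    then have "outcome_of (L \<oplus> deactivate K) = \<P>" by (simp add: outcome_sum_inactive)
    then have "outcome_of (G \<oplus> deactivate K) = \<N>"
      using \<open>active G\<close> that outcome_sum_N_leftI by blast
    moreover have "outcome_of (K \<oplus> deactivate K) = \<P>"
      using assms(2) by (rule outcome_sum_deactivate)
    ultimately show False using assms(1) by (simp add: game_eq_def)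
  qed
  ultimately show ?thesis by (simp add: locally_active_def)
qed

definition reversible_extension :: "game \<Rightarrow> game \<Rightarrow> bool" where
  "reversible_extension G K \<longleftrightarrow> active G = active K \<and> options K |\<subseteq>| options G \<and>
    (\<forall>L |\<in>| options G. L |\<notin>| options K \<longrightarrow> K |\<in>| options L)"

lemma reversible_extension_winning_option:
  assumes extension: "reversible_extension G K"
    and inherited: "locally_active K \<longrightarrow> locally_active G"
    and some_active: "active K \<or> active X"
    and option_L: "L |\<in>| options G"
    and outcome_L: "outcome_of (L \<oplus> X) = \<P>"
  shows "outcome_of (K \<oplus> X) = \<N>"
proof -
  consider (common) "L |\<in>| options K"
    | (reverted) "K |\<in>| options L" "active L \<or> active X"
    | (inactive) "\<not> active L" "\<not> active X"
    using extension option_L by (auto simp: reversible_extension_def)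
  then show ?thesis
  proof cases
    case common
    then show ?thesis using some_active outcome_L outcome_sum_N_leftI by blast
  next
    case reverted
    then show ?thesis using outcome_L outcome_sum_N_leftI[of L X K] outcome_neq_N_iff by fastforce
  next
    case inactive
    then have "\<not> locally_active G" using option_L unfolding locally_active_def by blast
    then obtain K' where "K' |\<in>| options K" "\<not> active K'"
      using inherited some_active inactive unfolding locally_active_def by blast
    then show ?thesis using some_active inactive outcome_sum_inactive outcome_sum_N_leftI by blast
  qed
qed

lemma reversible_extension_game_eq:
  assumes extension: "reversible_extension G K"
    and inherited: "locally_active K \<longrightarrow> locally_active G"
  shows "G \<doteq> K"
  unfolding game_eq_def
proof
  have active_eq: "active G = active K" and options_subset: "options K |\<subseteq>| options G"
    using extension by (simp_all add: reversible_extension_def)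
  fix X
  show "outcome_of (G \<oplus> X) = outcome_of (K \<oplus> X)"
  proof (induction X rule: option_induct)
    case (option X)
    have "outcome_of (G \<oplus> X) = \<N> \<longleftrightarrow> outcome_of (K \<oplus> X) = \<N>"
    proof
      assume "outcome_of (G \<oplus> X) = \<N>"
      then have some_active: "active K \<or> active X"
        and "(\<exists>L |\<in>| options G. outcome_of (L \<oplus> X) = \<P>) \<or>
          (\<exists>X' |\<in>| options X. outcome_of (K \<oplus> X') = \<P>)"
        unfolding outcome_sum_eq_N_iff[of G] active_eq using option by auto
      then show "outcome_of (K \<oplus> X) = \<N>"
        using reversible_extension_winning_option[OF extension inherited some_active]
          outcome_sum_N_rightI[OF some_active] by blast
    next
      assume "outcome_of (K \<oplus> X) = \<N>"
      then show "outcome_of (G \<oplus> X) = \<N>"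
        unfolding outcome_sum_eq_N_iff[of G] outcome_sum_eq_N_iff[of K] active_eq
        using option options_subset by auto
    qed
    then show ?case using outcome_neq_N_iff by metis
  qed
qed

lemma reversible_extension_game_eq_iff:
  assumes "reversible_extension G K"
  shows "G \<doteq> K \<longleftrightarrow> (locally_active K \<longrightarrow> locally_active G)"
  using assms reversible_extension_game_eq game_eq_imp_locally_active by blast

lemma active_nimber [simp]: "active (nimber \<gamma> i) = \<gamma> i"
  by (subst nimber.simps) simp

lemma fset_options_nimber: "fset (options (nimber \<gamma> i)) = nimber \<gamma> ` {..<i}"
  by (subst nimber.simps) (simp add: Abs_fset_inverse atLeast0LessThan)

lemma locally_active_nimber_iff: "locally_active (nimber \<gamma> m) \<longleftrightarrow> (\<forall>i\<le>m. \<gamma> i)"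
  by (auto simp: locally_active_def fset_options_nimber le_less)

lemma mex_notin: "finite A \<Longrightarrow> mex A \<notin> A"
  unfolding mex_def by (metis LeastI ex_new_if_finite infinite_UNIV_nat)

lemma less_mex_in: "i < mex A \<Longrightarrow> i \<in> A"
  unfolding mex_def using not_less_Least by blast

lemma reversible_extension_nimber_mex:
  assumes "finite A" "active G = \<gamma> (mex A)" "fset (options G) = nimber \<gamma> ` A"
  shows "reversible_extension G (nimber \<gamma> (mex A))"
proof -
  have "nimber \<gamma> (mex A) |\<in>| options (nimber \<gamma> k)"
    if "k \<in> A" "nimber \<gamma> k |\<notin>| options (nimber \<gamma> (mex A))" for k
  proof -
    have "k \<noteq> mex A" using \<open>k \<in> A\<close> assms(1) mex_notin by blast
    moreover have "\<not> k < mex A" using that(2) by (auto simp: fset_options_nimber)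
    ultimately show ?thesis by (simp add: fset_options_nimber)
  qed
  moreover have "options (nimber \<gamma> (mex A)) |\<subseteq>| options G"
    using less_mex_in by (auto simp: less_eq_fset.rep_eq fset_options_nimber assms(3))
  ultimately show ?thesis by (simp add: reversible_extension_def assms(2,3))
qed

theorem theorem3p50:
  fixes \<gamma> :: "nat \<Rightarrow> bool" and A :: "nat set" and m :: nat
  assumes "finite A"
    and "m = mex A"
  shows "Game (Abs_fset (nimber \<gamma> ` A)) (\<gamma> m) \<doteq> nimber \<gamma> m \<longleftrightarrow>
    (\<exists>i\<le>m. \<not> \<gamma> i) \<or> (\<forall>i\<in>A. \<gamma> i)"
proof -
  define G where "G = Game (Abs_fset (nimber \<gamma> ` A)) (\<gamma> m)"
  have active_G: "active G = \<gamma> m" and options_G: "fset (options G) = nimber \<gamma> ` A"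
    using assms(1) by (simp_all add: G_def Abs_fset_inverse)
  have "reversible_extension G (nimber \<gamma> m)"
    using reversible_extension_nimber_mex assms active_G options_G by simp
  then have "G \<doteq> nimber \<gamma> m \<longleftrightarrow> (locally_active (nimber \<gamma> m) \<longrightarrow> locally_active G)"
    by (rule reversible_extension_game_eq_iff)
  also have "\<dots> \<longleftrightarrow> ((\<forall>i\<le>m. \<gamma> i) \<longrightarrow> \<gamma> m \<and> (\<forall>i\<in>A. \<gamma> i))"
    by (simp add: locally_active_nimber_iff locally_active_def[of G] active_G options_G)
  also have "\<dots> \<longleftrightarrow> (\<exists>i\<le>m. \<not> \<gamma> i) \<or> (\<forall>i\<in>A. \<gamma> i)" by blast
  finally show ?thesis unfolding G_def .
qed

end
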